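(* Fix an integer $s\ge 1$. Then $d^s(k,n)=\binom{n-1}{k}$ for all but finitely many pairs of integers $(k,n)$ with $1<k<n-1$ (the number of exceptional pairs depending on $s$).
   Context: For a finite set $X$ of positive integers, write $\sum X=\sum_{x\in X}x$. Let $A$ be a finite set of positive integers and $s\ge 1$ an integer. A subset $B\subseteq A$ is an $s$-divisor of $A$ if $\sum B\mid s\sum A$. The number of $k$-element subsets of $A$ that are $s$-divisors of $A$ is denoted $d^s_k(A)$, and $d^s(k,n)$ denotes the maximum value of $d^s_k(A)$ over all sets $A$ of $n$ positive integers. *)

theory Defs
  imports Main
begin

definition s_divisor :: "nat \<Rightarrow> nat set \<Rightarrow> nat set \<Rightarrow> bool" where
  "s_divisor s A B \<longleftrightarrow> B \<subseteq> A \<and> \<Sum>B dvd s * \<Sum>A"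

definition num_s_divisors :: "nat \<Rightarrow> nat \<Rightarrow> nat set \<Rightarrow> nat" where
  "num_s_divisors s k A = card {B. card B = k \<and> s_divisor s A B}"

definition pos_sets :: "nat \<Rightarrow> nat set set" where
  "pos_sets n = {A. finite A \<and> card A = n \<and> (\<forall>a\<in>A. 0 < a)}"

definition max_s_divisors :: "nat \<Rightarrow> nat \<Rightarrow> nat \<Rightarrow> nat" where
  "max_s_divisors s k n = Max (num_s_divisors s k ` pos_sets n)"

text \<open>\<^const>\<open>Max\<close> is meaningful only for finite nonempty sets; the following two facts
  show that the maximum in \<^const>\<open>max_s_divisors\<close> is always a genuine one.\<close>

lemma num_s_divisors_image_nonempty: "num_s_divisors s k ` pos_sets n \<noteq> {}"
proof -
  have "{1..n} \<in> pos_sets n"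
    by (simp add: pos_sets_def)
  then show ?thesis by blast
qed

lemma num_s_divisors_le:
  assumes "A \<in> pos_sets n"
  shows "num_s_divisors s k A \<le> n choose k"
proof -
  have fin: "finite A" and n: "card A = n"
    using assms by (auto simp: pos_sets_def)
  have "num_s_divisors s k A \<le> card {B. B \<subseteq> A \<and> card B = k}"
    unfolding num_s_divisors_def s_divisor_def
    by (rule card_mono) (use fin in auto)
  also have "\<dots> = n choose k"
    using n_subsets[OF fin] n by simp
  finally show ?thesis .
qed

lemma finite_num_s_divisors_image: "finite (num_s_divisors s k ` pos_sets n)"
  by (rule finite_subset[of _ "{..n choose k}"]) (auto simp: num_s_divisors_le)

end

theory Submission
  imports Complex_Main Defs
begin

text \<open>Divide all elements by \<open>\<Sum>A\<close>, so that the weights \<open>w\<close> sum to \<open>1\<close> and a divisor is a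
  \<open>k\<close>-set of weight \<open>s / m\<close>. If some weight exceeds \<open>s / (s + 1)\<close>, no divisor contains that
  element. Otherwise let \<open>n\<close> be large.

  If \<open>16 k \<ge> n\<close>: few weights \<open>s / m\<close> are at least a constant \<open>\<epsilon>\<close>, and sets with a prescribed weight
  are rare because one element is determined by the others; counting pairs (divisor, element outside it)
  by weight bounds the divisors of weight \<open>\<ge> \<epsilon>\<close> by \<open>O(1/k)\<close> times \<open>(n - 1) choose k\<close>. The second
  moment of \<open>1 - w B\<close> shows that the \<open>k\<close>-sets of weight \<open>< \<epsilon>\<close> number at most
  \<open>1 - 2 \<epsilon>\<close> times \<open>(n - 1) choose k\<close>.

  If \<open>16 k \<le> n\<close>, it suffices to find \<open>(n - 1) choose (k - 1)\<close> non-divisors. When two weights are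
  at least \<open>12 s / n\<close>, most \<open>k\<close>-sets containing one of them are non-divisors. Otherwise a positive
  proportion of the weights have order \<open>1 / n\<close>, so by pigeonhole there are two disjoint pairs with
  differences \<open>O(1 / n\<^sup>2)\<close>. For a close pair \<open>x, y\<close> the equation \<open>s / m' - s / m = w y - w x\<close> has boundedly
  many relevant solutions, so for most \<open>(k - 1)\<close>-sets \<open>C\<close> at least one of \<open>C \<union> {x}\<close>, \<open>C \<union> {y}\<close> is a
  non-divisor.\<close>

subsection \<open>Counting subsets\<close>

lemma binomial_Suc_mult: "Suc i * (n choose Suc i) = (n - i) * (n choose i)"
  by (simp only: binomial_absorption binomial_absorb_comp)

text \<open>Double counting of pairs (\<open>B\<close>, \<open>x\<close>) with \<open>x\<close> in
  \<open>B\<close>. Such a pair is determined by \<open>B - {x}\<close> and \<open>sum w B\<close>,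
  which bounds the pairs by \<open>card V\<close> times the number of (\<open>j\<close> - 1)-sets,
  while each \<open>B\<close> lies in \<open>j\<close> of them. The saving
  \<open>card A + 1 - j\<close> is strong when \<open>j\<close> is small against
  \<open>card A\<close>.\<close>

lemma card_subsets_fixed_sums_up:
  fixes w :: "'a \<Rightarrow> real"
  assumes fin: "finite A" and inj: "inj_on w A" and V: "finite V" and j: "0 < j"
  shows "card {B. B \<subseteq> A \<and> card B = j \<and> sum w B \<in> V} * (card A + 1 - j)
           \<le> card V * (card A choose j)"
proof -
  define F where "F = {B. B \<subseteq> A \<and> card B = j \<and> sum w B \<in> V}"
  obtain i where i: "j = Suc i" using j by (cases j) auto
  have finF: "finite F" unfolding F_def using fin by simp
  have finB: "finite B" if "B \<in> F" for B
    using that fin finite_subset unfolding F_def by blast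
  \<comment> \<open>The removed element can be read off the weights.\<close>
  let ?g = "\<lambda>(B, x). (B - {x}, sum w B)"
  have "inj_on ?g (Sigma F (\<lambda>B. B))"
  proof (rule inj_onI, clarify)
    fix B x B' x'
    assume B: "B \<in> F" "x \<in> B" and B': "B' \<in> F" "x' \<in> B'"
      and d: "B - {x} = B' - {x'}" and e: "sum w B = sum w B'"
    have "w x = sum w B - sum w (B - {x})" "w x' = sum w B' - sum w (B' - {x'})"
      using B B' finB by (simp_all add: sum_diff1)
    hence "w x = w x'" using d e by simp
    moreover have "x \<in> A" "x' \<in> A" using B B' unfolding F_def by auto
    ultimately have "x = x'" using inj by (meson inj_onD)
    thus "B = B' \<and> x = x'" using d B B' by blast
  qed
  moreover have "?g ` Sigma F (\<lambda>B. B) \<subseteq> {C. C \<subseteq> A \<and> card C = i} \<times> V"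
    using i unfolding F_def by auto
  ultimately have "card (Sigma F (\<lambda>B. B)) \<le> card ({C. C \<subseteq> A \<and> card C = i} \<times> V)"
    using fin V by (intro card_inj_on_le) auto
  moreover have "card (Sigma F (\<lambda>B. B)) = card F * j"
  proof -
    have "card (Sigma F (\<lambda>B. B)) = (\<Sum>B\<in>F. card B)"
      using finF finB by (intro card_SigmaI) blast+
    also have "\<dots> = (\<Sum>B\<in>F. j)" by (rule sum.cong) (auto simp: F_def)
    finally show ?thesis by simp
  qed
  ultimately have "card F * j \<le> (card A choose i) * card V"
    using fin by (simp add: card_cartesian_product n_subsets)
  from mult_le_mono1[OF this, of "card A - i"]
  have "card F * j * (card A - i) \<le> card V * ((card A - i) * (card A choose i))"
    by (simp only: ac_simps)
  also have "\<dots> = card V * (j * (card A choose j))"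
    unfolding i by (simp only: binomial_Suc_mult)
  finally have "j * (card F * (card A - i)) \<le> j * (card V * (card A choose j))"
    by (simp only: ac_simps)
  hence "card F * (card A - i) \<le> card V * (card A choose j)" using j by (simp only: mult_le_cancel1)
  thus ?thesis unfolding F_def i by simp
qed

text \<open>The dual count adds an element instead of removing one. Its saving \<open>j + 1\<close>
  is the useful one when \<open>j\<close> is comparable to \<open>card A\<close>.\<close>

lemma card_subsets_fixed_sums_down:
  fixes w :: "'a \<Rightarrow> real"
  assumes fin: "finite A" and inj: "inj_on w A" and V: "finite V" and j: "j < card A"
  shows "card {B. B \<subseteq> A \<and> card B = j \<and> sum w B \<in> V} * (j + 1)
           \<le> card V * (card A choose j)"
proof -
  define F where "F = {B. B \<subseteq> A \<and> card B = j \<and> sum w B \<in> V}"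
  have finF: "finite F" unfolding F_def using fin by simp
  have finB: "finite B" if "B \<in> F" for B
    using that fin finite_subset unfolding F_def by blast
  let ?g = "\<lambda>(B, x). (insert x B, sum w B)"
  have "inj_on ?g (Sigma F (\<lambda>B. A - B))"
  proof (rule inj_onI, clarify)
    fix B x B' x'
    assume B: "B \<in> F" "x \<in> A" "x \<notin> B" and B': "B' \<in> F" "x' \<in> A" "x' \<notin> B'"
      and d: "insert x B = insert x' B'" and e: "sum w B = sum w B'"
    have "w x = sum w (insert x B) - sum w B" "w x' = sum w (insert x' B') - sum w B'"
      using B B' finB by simp_all
    hence "w x = w x'" using d e by simp
    hence x: "x = x'" using inj B B' by (meson inj_onD)
    with d B(3) B'(3) have "B = B'" by (simp add: insert_ident)
    with x show "B = B' \<and> x = x'" by simp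
  qed
  moreover have "?g ` Sigma F (\<lambda>B. A - B) \<subseteq> {C. C \<subseteq> A \<and> card C = Suc j} \<times> V"
  proof (intro image_subsetI)
    fix p assume "p \<in> Sigma F (\<lambda>B. A - B)"
    then obtain B x where p: "p = (B, x)" "B \<in> F" "x \<in> A" "x \<notin> B" by blast
    have "finite B" using p(2) by (rule finB)
    hence "card (insert x B) = Suc (card B)" using p(4) by (rule card_insert_disjoint)
    moreover have "B \<subseteq> A" "card B = j" "sum w B \<in> V" using p(2) by (auto simp: F_def)
    ultimately show "?g p \<in> {C. C \<subseteq> A \<and> card C = Suc j} \<times> V"
      using p by simp
  qed
  ultimately have "card (Sigma F (\<lambda>B. A - B)) \<le> card ({C. C \<subseteq> A \<and> card C = Suc j} \<times> V)"
    using fin V by (intro card_inj_on_le) auto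
  moreover have "card (Sigma F (\<lambda>B. A - B)) = card F * (card A - j)"
  proof -
    have "card (Sigma F (\<lambda>B. A - B)) = (\<Sum>B\<in>F. card (A - B))"
      using finF fin by (intro card_SigmaI) auto
    also have "\<dots> = (\<Sum>B\<in>F. card A - j)"
    proof (rule sum.cong[OF refl])
      fix B assume B: "B \<in> F"
      hence "B \<subseteq> A" "card B = j" by (auto simp: F_def)
      thus "card (A - B) = card A - j" using finB[OF B] by (simp add: card_Diff_subset)
    qed
    finally show ?thesis by simp
  qed
  ultimately have "card F * (card A - j) \<le> (card A choose Suc j) * card V"
    using fin by (simp add: card_cartesian_product n_subsets)
  from mult_le_mono1[OF this, of "Suc j"]
  have "card F * (card A - j) * Suc j \<le> card V * (Suc j * (card A choose Suc j))"
    by (simp only: ac_simps)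
  also have "\<dots> = card V * ((card A - j) * (card A choose j))"
    by (simp only: binomial_Suc_mult)
  finally have "(card A - j) * (card F * Suc j) \<le> (card A - j) * (card V * (card A choose j))"
    by (simp only: ac_simps)
  hence "card F * Suc j \<le> card V * (card A choose j)" using j by (simp only: mult_le_cancel1)
  thus ?thesis unfolding F_def by simp
qed

text \<open>For the normalised weights, \<open>\<Sum>B dvd s * \<Sum>A\<close> says that the weight of \<open>B\<close> lies in this set.\<close>

definition multiples_of_unit_fracs :: "nat \<Rightarrow> real set" where
  "multiples_of_unit_fracs s = {real s / real m |m. 0 < m}"

text \<open>A value \<open>s / m\<close> that is at least \<open>v\<close> forces \<open>m\<close>
  to be at most \<open>s / v\<close>.\<close>

lemma multiples_of_unit_fracs_above:
  assumes "0 < v"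
  shows "finite (multiples_of_unit_fracs s \<inter> {v..})"
    and "real (card (multiples_of_unit_fracs s \<inter> {v..})) \<le> real s / v"
proof -
  define L where "L = nat \<lfloor>real s / v\<rfloor>"
  have sub: "multiples_of_unit_fracs s \<inter> {v..} \<subseteq> (\<lambda>m. real s / real m) ` {1..L}"
  proof
    fix x assume "x \<in> multiples_of_unit_fracs s \<inter> {v..}"
    then obtain m where m: "0 < m" "x = real s / real m" "v \<le> x"
      unfolding multiples_of_unit_fracs_def by auto
    have "real m \<le> real s / v"
      using m assms by (simp add: pos_le_divide_eq mult.commute)
    hence "m \<le> L" unfolding L_def by linarith
    thus "x \<in> (\<lambda>m. real s / real m) ` {1..L}" using m by auto
  qed
  show "finite (multiples_of_unit_fracs s \<inter> {v..})"
    using sub finite_surj by blast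
  have "card (multiples_of_unit_fracs s \<inter> {v..}) \<le> L"
    using surj_card_le[OF _ sub] by simp
  moreover have "real L \<le> real s / v" unfolding L_def using assms by simp
  ultimately show "real (card (multiples_of_unit_fracs s \<inter> {v..})) \<le> real s / v" by linarith
qed

lemma card_subsets_containing:
  assumes "finite A" "X \<subseteq> A" "card X \<le> k"
  shows "card {B. B \<subseteq> A \<and> card B = k \<and> X \<subseteq> B} = (card A - card X) choose (k - card X)"
proof -
  have X: "finite X" using assms finite_subset by blast
  have "bij_betw (\<lambda>C. C \<union> X) {C. C \<subseteq> A - X \<and> card C = k - card X}
          {B. B \<subseteq> A \<and> card B = k \<and> X \<subseteq> B}"
  proof (rule bij_betw_byWitness[where f' = "\<lambda>B. B - X"])
    show "(\<lambda>C. C \<union> X) ` {C. C \<subseteq> A - X \<and> card C = k - card X}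
            \<subseteq> {B. B \<subseteq> A \<and> card B = k \<and> X \<subseteq> B}"
    proof clarify
      fix C assume C: "C \<subseteq> A - X" "card C = k - card X"
      have "finite C" using C(1) assms(1) by (meson finite_Diff finite_subset)
      then have "card (C \<union> X) = card C + card X"
        using C(1) X by (intro card_Un_disjoint) auto
      thus "C \<union> X \<subseteq> A \<and> card (C \<union> X) = k \<and> X \<subseteq> C \<union> X"
        using C assms by auto
    qed
    show "(\<lambda>B. B - X) ` {B. B \<subseteq> A \<and> card B = k \<and> X \<subseteq> B}
            \<subseteq> {C. C \<subseteq> A - X \<and> card C = k - card X}"
      using X by (auto simp: card_Diff_subset)
  qed blast+
  from bij_betw_same_card[OF this]
  have "card {B. B \<subseteq> A \<and> card B = k \<and> X \<subseteq> B} = card {C. C \<subseteq> A - X \<and> card C = k - card X}"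
    by (rule sym)
  also have "\<dots> = card (A - X) choose (k - card X)"
    using assms(1) by (simp add: n_subsets)
  finally show ?thesis using X assms(2) by (simp add: card_Diff_subset)
qed

lemma card_subsets_avoiding:
  assumes "finite A" "X \<subseteq> A"
  shows "card {B. B \<subseteq> A \<and> card B = k \<and> X \<inter> B = {}} = (card A - card X) choose k"
proof -
  have "{B. B \<subseteq> A \<and> card B = k \<and> X \<inter> B = {}} = {B. B \<subseteq> A - X \<and> card B = k}" by auto
  moreover have "finite X" using assms finite_subset by blast
  ultimately show ?thesis using assms by (simp add: n_subsets card_Diff_subset)
qed

text \<open>Pigeonhole twice: deleting the first colliding pair costs two elements, hence the
  surplus 2, and keeps the second pair disjoint from it.\<close>

lemma two_disjoint_collisions:
  assumes "finite M" "finite T" "f ` M \<subseteq> T" "card T + 2 < card M"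
  obtains x y x' y' where "{x, y, x', y'} \<subseteq> M" "distinct [x, y, x', y']" "f x = f y" "f x' = f y'"
proof -
  have collision: "\<exists>x y. x \<in> N \<and> y \<in> N \<and> x \<noteq> y \<and> f x = f y" if "N \<subseteq> M" "card T < card N" for N
  proof -
    have "card (f ` N) \<le> card T" using assms that by (intro card_mono) auto
    hence "\<not> inj_on f N" using that by (intro pigeonhole) simp
    thus ?thesis unfolding inj_on_def by blast
  qed
  obtain x y where xy: "x \<in> M" "y \<in> M" "x \<noteq> y" "f x = f y"
    using collision[of M] assms by auto
  have "card (M - {x, y}) = card M - 2" using xy by (simp add: card_Diff_subset)
  hence "card T < card (M - {x, y})" using assms(4) by linarith
  from collision[OF Diff_subset this]
  obtain x' y' where "x' \<in> M - {x, y}" "y' \<in> M - {x, y}" "x' \<noteq> y'" "f x' = f y'"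
    by blast
  thus ?thesis using that[of x y x' y'] xy by auto
qed

subsection \<open>Normalised weights\<close>

text \<open>Integrality is dropped here. Distinctness of the integers survives as
  \<open>inj\<close>, which lets an element be recovered from a difference of weights.\<close>

locale unit_weights =
  fixes A :: "'a set" and w :: "'a \<Rightarrow> real" and s k :: nat
  assumes fin: "finite A" and inj: "inj_on w A"
    and pos: "x \<in> A \<Longrightarrow> 0 < w x" and total: "sum w A = 1"
    and s: "1 \<le> s" and k: "1 < k" "k + 1 < card A"
begin

abbreviation "n \<equiv> card A"

definition k_sets :: "'a set set" where
  "k_sets = {B. B \<subseteq> A \<and> card B = k}"

definition divisors :: "'a set set" where
  "divisors = {B \<in> k_sets. sum w B \<in> multiples_of_unit_fracs s}"

lemma finite_k_sets: "finite k_sets"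
  unfolding k_sets_def using fin by simp

lemma finite_divisors: "finite divisors"
  unfolding divisors_def using finite_k_sets by simp

lemma finite_subset_A: "B \<subseteq> A \<Longrightarrow> finite B"
  using fin finite_subset by blast

lemma sum_weights_le: "B \<subseteq> A \<Longrightarrow> sum w B \<le> 1"
  unfolding total[symmetric] using fin pos by (intro sum_mono2) (auto intro: less_imp_le)

lemma weight_le_sum: "B \<subseteq> A \<Longrightarrow> x \<in> B \<Longrightarrow> w x \<le> sum w B"
  using pos finite_subset_A by (intro member_le_sum) (auto intro: less_imp_le)

text \<open>A divisor omits some element of positive weight, so \<open>s / m\<close> is strictly
  below 1 and \<open>m\<close> is at least \<open>s + 1\<close>.\<close>

lemma sum_weights_divisor_le:
  assumes "B \<in> divisors"
  shows "sum w B \<le> real s / real (s + 1)"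
proof -
  have B: "B \<subseteq> A" "card B = k" "sum w B \<in> multiples_of_unit_fracs s"
    using assms by (auto simp: divisors_def k_sets_def)
  then obtain m where m: "0 < m" "sum w B = real s / real m"
    by (auto simp: multiples_of_unit_fracs_def)
  have "B \<noteq> A" using B(2) k by auto
  then obtain x where x: "x \<in> A" "x \<notin> B" using B(1) by blast
  have "sum w (insert x B) \<le> 1" using B(1) x by (intro sum_weights_le) auto
  hence "sum w B < 1" using x pos[of x] finite_subset_A[OF B(1)] by simp
  hence "s < m" using m by simp
  hence "real s / real m \<le> real s / real (s + 1)" by (intro divide_left_mono) auto
  thus ?thesis using m by simp
qed

lemma card_divisors_le_if_dominant:
  assumes "x \<in> A" "real s / real (s + 1) < w x"
  shows "card divisors \<le> (n - 1) choose k"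
proof -
  have "divisors \<subseteq> {B. B \<subseteq> A \<and> card B = k \<and> {x} \<inter> B = {}}"
  proof
    fix B assume B: "B \<in> divisors"
    hence BA: "B \<subseteq> A" "card B = k" by (auto simp: divisors_def k_sets_def)
    have "x \<notin> B" using weight_le_sum[OF BA(1), of x] sum_weights_divisor_le[OF B] assms by auto
    thus "B \<in> {B. B \<subseteq> A \<and> card B = k \<and> {x} \<inter> B = {}}" using BA by simp
  qed
  hence "card divisors \<le> card {B. B \<subseteq> A \<and> card B = k \<and> {x} \<inter> B = {}}"
    using fin by (intro card_mono) auto
  also have "\<dots> = (n - 1) choose k"
    using card_subsets_avoiding[OF fin, of "{x}" k] assms by simp
  finally show ?thesis .
qed

subsection \<open>Large \<open>k\<close>\<close>

lemma card_k_sets_filter: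
  "real (card {B \<in> k_sets. P B}) = (\<Sum>B\<in>k_sets. if P B then 1 else 0)"
  using finite_k_sets by (simp add: sum.If_cases Int_def)

text \<open>The indicator form over all of \<open>A\<close> allows sums over sets and sums over
  elements to be interchanged.\<close>

lemma complement_weight:
  assumes "B \<subseteq> A"
  shows "1 - sum w B = (\<Sum>x\<in>A. if x \<in> B then 0 else w x)"
proof -
  have "(\<Sum>x\<in>A. if x \<in> B then 0 else w x) = sum w (A - B)"
    using fin by (simp add: sum.If_cases Diff_eq)
  also have "\<dots> = sum w A - sum w B" using fin assms by (rule sum_diff)
  finally show ?thesis using total by simp
qed

text \<open>Expand the square: \<open>w x * w y\<close> is counted once for each
  \<open>k\<close>-set avoiding both \<open>x\<close> and \<open>y\<close>, and the number of these
  depends only on whether \<open>x = y\<close>. Since \<open>total\<close> is 1, the off-diagonal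
  count appears with coefficient 1.\<close>

lemma second_moment_complement:
  "(\<Sum>B\<in>k_sets. (1 - sum w B)\<^sup>2)
     = real ((n - 2) choose k)
       + (real ((n - 1) choose k) - real ((n - 2) choose k)) * (\<Sum>x\<in>A. (w x)\<^sup>2)"
proof -
  let ?C1 = "real ((n - 1) choose k)" and ?C2 = "real ((n - 2) choose k)"
  have count: "real (card {B \<in> k_sets. x \<notin> B \<and> y \<notin> B}) = (if x = y then ?C1 else ?C2)"
    if "x \<in> A" "y \<in> A" for x y
  proof -
    have "{B \<in> k_sets. x \<notin> B \<and> y \<notin> B} = {B. B \<subseteq> A \<and> card B = k \<and> {x, y} \<inter> B = {}}"
      by (auto simp: k_sets_def)
    thus ?thesis using card_subsets_avoiding[OF fin, of "{x, y}" k] that by (auto simp: numeral_2_eq_2)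
  qed
  have "(\<Sum>B\<in>k_sets. (1 - sum w B)\<^sup>2)
      = (\<Sum>B\<in>k_sets. \<Sum>x\<in>A. \<Sum>y\<in>A. w x * w y * (if x \<notin> B \<and> y \<notin> B then 1 else 0))"
  proof (rule sum.cong[OF refl])
    fix B assume "B \<in> k_sets"
    hence "B \<subseteq> A" by (simp add: k_sets_def)
    show "(1 - sum w B)\<^sup>2
        = (\<Sum>x\<in>A. \<Sum>y\<in>A. w x * w y * (if x \<notin> B \<and> y \<notin> B then 1 else 0))"
      unfolding complement_weight[OF \<open>B \<subseteq> A\<close>] power2_eq_square sum_product
      by (intro sum.cong refl) auto
  qed
  also have "\<dots> = (\<Sum>x\<in>A. \<Sum>y\<in>A. \<Sum>B\<in>k_sets. w x * w y * (if x \<notin> B \<and> y \<notin> B then 1 else 0))"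
    by (subst sum.swap, rule sum.cong[OF refl], rule sum.swap)
  also have "\<dots> = (\<Sum>x\<in>A. \<Sum>y\<in>A. w x * w y * (if x = y then ?C1 else ?C2))"
    by (intro sum.cong refl, subst sum_distrib_left[symmetric])
       (simp only: card_k_sets_filter[symmetric] count)
  also have "\<dots> = (\<Sum>x\<in>A. \<Sum>y\<in>A. ?C2 * (w x * w y) + (if y = x then (?C1 - ?C2) * (w x)\<^sup>2 else 0))"
    by (intro sum.cong refl) (auto simp: algebra_simps power2_eq_square)
  also have "\<dots> = ?C2 * (sum w A * sum w A) + (?C1 - ?C2) * (\<Sum>x\<in>A. (w x)\<^sup>2)"
    using fin by (simp add: sum.distrib sum_distrib_left[symmetric] sum_product[symmetric]
        sum_distrib_right[symmetric])
  finally show ?thesis using total by simp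
qed

text \<open>Chebyshev's argument: every set counted contributes at least
  \<open>(1 - \<epsilon>)\<^sup>2\<close> to the second moment of the omitted weight. The sum of
  squared weights is at most the largest weight, because the weights sum to 1.\<close>

lemma card_light_k_sets:
  assumes light: "\<And>x. x \<in> A \<Longrightarrow> w x \<le> real s / real (s + 1)" and "\<epsilon> \<le> 1"
  shows "real (card {B \<in> k_sets. sum w B < \<epsilon>}) * (1 - \<epsilon>)\<^sup>2
           \<le> real ((n - 1) choose k) * (1 - real k / (real (s + 1) * real n))"
proof -
  define q where "q = (\<Sum>x\<in>A. (w x)\<^sup>2)"
  define C1 C2 where "C1 = real ((n - 1) choose k)" and "C2 = real ((n - 2) choose k)"
  define M where "M = real s / real (s + 1)"
  have M: "1 - M = 1 / real (s + 1)" unfolding M_def by (simp add: field_simps)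
  have "q \<le> (\<Sum>x\<in>A. M * w x)"
    unfolding q_def power2_eq_square
    using light pos by (intro sum_mono mult_right_mono) (auto simp: M_def intro: less_imp_le)
  also have "\<dots> = M" using total by (simp add: sum_distrib_left[symmetric])
  finally have qM: "q \<le> M" .
  have "(n - 1 - k) * ((n - 1) choose k) = (n - 1) * ((n - 2) choose k)"
    using binomial_absorb_comp[of "n - 1" k] by (simp add: numeral_2_eq_2)
  hence "real (n - 1 - k) * C1 = real (n - 1) * C2"
    unfolding C1_def C2_def of_nat_mult[symmetric] by (rule arg_cong)
  moreover have "real (n - 1 - k) = real n - 1 - real k" "real (n - 1) = real n - 1"
    using k by (simp_all add: of_nat_diff)
  ultimately have "(real n - 1 - real k) * C1 = (real n - 1) * C2" by (simp only:)
  hence C21: "C2 = C1 * (1 - real k / (real n - 1))" using k by (simp add: field_simps)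
  have "real k / real n \<le> real k / (real n - 1)" using k by (intro divide_left_mono) auto
  hence C2: "C2 \<le> C1 * (1 - real k / real n)" unfolding C21 C1_def by (intro mult_left_mono) auto
  \<comment> \<open>The inequality \<open>C2 \<le> C1\<close> makes the coefficient of
    \<open>q\<close> nonnegative, so that \<open>q\<close> may be replaced by its upper bound
    \<open>M\<close>.\<close>
  have "C1 * (1 - real k / (real n - 1)) \<le> C1 * 1"
    using k unfolding C1_def by (intro mult_left_mono) auto
  hence "C2 \<le> C1" unfolding C21 by simp
  have "real (card {B \<in> k_sets. sum w B < \<epsilon>}) * (1 - \<epsilon>)\<^sup>2
      = (\<Sum>B\<in>k_sets. if sum w B < \<epsilon> then (1 - \<epsilon>)\<^sup>2 else 0)"
    unfolding card_k_sets_filter sum_distrib_right by (intro sum.cong refl) auto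
  also have "\<dots> \<le> (\<Sum>B\<in>k_sets. (1 - sum w B)\<^sup>2)"
    using \<open>\<epsilon> \<le> 1\<close> by (intro sum_mono) (auto intro!: power_mono)
  also have "\<dots> = C2 + (C1 - C2) * q"
    unfolding second_moment_complement C1_def C2_def q_def ..
  also have "\<dots> \<le> C2 + (C1 - C2) * M"
    using qM \<open>C2 \<le> C1\<close> by (intro add_left_mono mult_left_mono) auto
  also have "\<dots> = C1 * M + C2 * (1 - M)" by (simp add: algebra_simps)
  also have "\<dots> \<le> C1 * M + C1 * (1 - real k / real n) * (1 - M)"
    using C2 M by (intro add_left_mono mult_right_mono) auto
  also have "\<dots> = C1 * (1 - (1 - M) * (real k / real n))" by (simp add: algebra_simps)
  finally show ?thesis unfolding M C1_def by simp
qed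

text \<open>Count pairs (divisor, omitted element) with the weight of the element. Each divisor
  receives at least \<open>1 / (s + 1)\<close>, and each \<open>x\<close> is omitted by at most
  \<open>c\<close> of the heavy divisors, so the total is at most \<open>c\<close>.\<close>

lemma card_divisors_above:
  assumes "0 < \<epsilon>"
  shows "real (card {B \<in> divisors. \<epsilon> \<le> sum w B})
           \<le> real (s + 1) * (real s / \<epsilon>) / real (k + 1) * real ((n - 1) choose k)"
proof -
  let ?G = "{B \<in> divisors. \<epsilon> \<le> sum w B}"
  let ?V = "multiples_of_unit_fracs s \<inter> {\<epsilon>..}"
  define c where "c = (real s / \<epsilon>) / real (k + 1) * real ((n - 1) choose k)"
  have each: "real (card {B \<in> ?G. x \<notin> B}) \<le> c" if x: "x \<in> A" for x
  proof -
    let ?H = "{B. B \<subseteq> A - {x} \<and> card B = k \<and> sum w B \<in> ?V}"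
    have H: "{B \<in> ?G. x \<notin> B} = ?H" by (auto simp: divisors_def k_sets_def)
    \<comment> \<open>Counting inside \<open>A - {x}\<close> produces \<open>n - 1\<close> in the
      binomial coefficient; \<open>k + 1 < n\<close> guarantees that an element can still be
      added.\<close>
    have "card ?H * (k + 1) \<le> card ?V * (card (A - {x}) choose k)"
    proof (rule card_subsets_fixed_sums_down)
      show "inj_on w (A - {x})" using inj by (rule inj_on_subset) auto
      show "finite ?V" using assms by (rule multiples_of_unit_fracs_above)
      show "k < card (A - {x})" using k x fin by simp
    qed (use fin in simp)
    hence "card ?H * (k + 1) \<le> card ?V * ((n - 1) choose k)" using x fin by simp
    hence "real (card ?H) * real (k + 1) \<le> real (card ?V) * real ((n - 1) choose k)"
      unfolding of_nat_mult[symmetric] by (rule of_nat_mono)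
    moreover have "real (card ?V) * real ((n - 1) choose k) \<le> (real s / \<epsilon>) * real ((n - 1) choose k)"
      using assms by (intro mult_right_mono multiples_of_unit_fracs_above) auto
    ultimately have "real (card ?H) * real (k + 1) \<le> (real s / \<epsilon>) * real ((n - 1) choose k)"
      by linarith
    hence "real (card ?H) \<le> (real s / \<epsilon>) * real ((n - 1) choose k) / real (k + 1)"
      by (subst pos_le_divide_eq) simp_all
    thus ?thesis unfolding c_def H by simp
  qed
  have "real (card ?G) = (\<Sum>B\<in>?G. 1)" by simp
  \<comment> \<open>Each divisor leaves out weight at least \<open>1 / (s + 1)\<close>.\<close>
  also have "\<dots> \<le> (\<Sum>B\<in>?G. real (s + 1) * (\<Sum>x\<in>A. if x \<in> B then 0 else w x))"
  proof (rule sum_mono)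
    fix B assume B: "B \<in> ?G"
    hence "sum w B \<le> real s / real (s + 1)" using sum_weights_divisor_le by simp
    hence "1 \<le> real (s + 1) * (1 - sum w B)" by (simp add: field_simps)
    thus "1 \<le> real (s + 1) * (\<Sum>x\<in>A. if x \<in> B then 0 else w x)"
      using B complement_weight[of B] by (simp add: divisors_def k_sets_def)
  qed
  also have "\<dots> = real (s + 1) * (\<Sum>x\<in>A. \<Sum>B\<in>?G. if x \<in> B then 0 else w x)"
    unfolding sum_distrib_left[symmetric] by (subst sum.swap) (rule refl)
  also have "(\<Sum>x\<in>A. \<Sum>B\<in>?G. if x \<in> B then 0 else w x) = (\<Sum>x\<in>A. w x * real (card {B \<in> ?G. x \<notin> B}))"
    using finite_divisors by (intro sum.cong refl) (simp add: sum.If_cases Int_def mult.commute)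
  also have "real (s + 1) * \<dots> \<le> real (s + 1) * (\<Sum>x\<in>A. w x * c)"
    using each pos by (intro mult_left_mono sum_mono) (auto intro: less_imp_le)
  also have "(\<Sum>x\<in>A. w x * c) = c"
    using total by (simp add: sum_distrib_right[symmetric])
  finally show ?thesis unfolding c_def by simp
qed

lemma card_divisors_le_dense:
  assumes light: "\<And>x. x \<in> A \<Longrightarrow> w x \<le> real s / real (s + 1)"
    and dense: "n \<le> 16 * k" and n: "32768 * (s + 1) ^ 4 \<le> n"
  shows "card divisors \<le> (n - 1) choose k"
proof -
  define r where "r = real (s + 1)"
  \<comment> \<open>Chosen so that \<open>4 * \<epsilon> = 1 / (16 * r)\<close>, which is at most
    \<open>k / (r * n)\<close> because \<open>n \<le> 16 * k\<close>.\<close>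
  define \<epsilon> where "\<epsilon> = 1 / (64 * r)"
  define C where "C = real ((n - 1) choose k)"
  define L where "L = real (card {B \<in> k_sets. sum w B < \<epsilon>})"
  define H where "H = real (card {B \<in> divisors. \<epsilon> \<le> sum w B})"
  have r: "1 \<le> r" "real s \<le> r" unfolding r_def by simp_all
  have \<epsilon>: "0 < \<epsilon>" "\<epsilon> \<le> 1 / 64" using r by (auto simp: \<epsilon>_def field_simps)
  have C: "0 \<le> C" unfolding C_def by simp
  have "L * (1 - \<epsilon>)\<^sup>2 \<le> C * (1 - real k / (r * real n))"
    unfolding L_def C_def r_def using \<epsilon> by (intro card_light_k_sets light) auto
  also have "\<dots> \<le> C * (1 - 4 * \<epsilon>)"
  proof -
    have "4 * \<epsilon> \<le> real k / (r * real n)"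
      using dense k r unfolding \<epsilon>_def by (simp add: field_simps)
    thus ?thesis using C by (intro mult_left_mono) auto
  qed
  \<comment> \<open>One factor \<open>1 - 2 * \<epsilon>\<close> is spent on cancelling
    \<open>(1 - \<epsilon>)\<^sup>2\<close>, which is at least as large; the other remains as the
    gain.\<close>
  also have "\<dots> \<le> C * ((1 - 2 * \<epsilon>) * (1 - 2 * \<epsilon>))"
    using C by (intro mult_left_mono) (auto simp: algebra_simps)
  finally have "L * (1 - \<epsilon>)\<^sup>2 \<le> C * (1 - 2 * \<epsilon>) * (1 - 2 * \<epsilon>)" by (simp add: mult.assoc)
  moreover have "L * (1 - 2 * \<epsilon>) \<le> L * (1 - \<epsilon>)\<^sup>2"
    unfolding L_def by (intro mult_left_mono) (auto simp: power2_eq_square algebra_simps)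
  ultimately have "L * (1 - 2 * \<epsilon>) \<le> C * (1 - 2 * \<epsilon>) * (1 - 2 * \<epsilon>)" by linarith
  hence L: "L \<le> C * (1 - 2 * \<epsilon>)" using \<epsilon> by (simp only: mult_le_cancel_right_pos)
  \<comment> \<open>The threshold is 16 * 2048: it makes \<open>k\<close> large enough for the heavy
    divisors to fit into the share \<open>2 * \<epsilon>\<close> left free by the light
    sets.\<close>
  have "real (32768 * (s + 1) ^ 4) \<le> real (16 * k)" using n dense by linarith
  hence kr: "2048 * r ^ 4 \<le> real k" unfolding r_def by simp
  have "r * (real s / \<epsilon>) = 64 * r * r * real s" unfolding \<epsilon>_def by simp
  also have "\<dots> \<le> 64 * r * r * r" using r by (intro mult_left_mono) auto
  also have "\<dots> = 2 * \<epsilon> * (2048 * r ^ 4)"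
    using r unfolding \<epsilon>_def by (simp add: field_simps power4_eq_xxxx)
  also have "\<dots> \<le> 2 * \<epsilon> * real (k + 1)" using kr \<epsilon> by (intro mult_left_mono) auto
  finally have "r * (real s / \<epsilon>) / real (k + 1) \<le> 2 * \<epsilon>" by (subst pos_divide_le_eq) auto
  hence "r * (real s / \<epsilon>) / real (k + 1) * C \<le> 2 * \<epsilon> * C" using C by (rule mult_right_mono)
  with card_divisors_above[OF \<epsilon>(1)] have H: "H \<le> 2 * \<epsilon> * C" unfolding H_def C_def r_def by linarith
  have "card divisors \<le> card ({B \<in> k_sets. sum w B < \<epsilon>} \<union> {B \<in> divisors. \<epsilon> \<le> sum w B})"
    using finite_k_sets finite_divisors by (intro card_mono) (auto simp: divisors_def)
  also have "\<dots> \<le> card {B \<in> k_sets. sum w B < \<epsilon>} + card {B \<in> divisors. \<epsilon> \<le> sum w B}"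
    by (rule card_Un_le)
  finally have "real (card divisors) \<le> L + H" unfolding L_def H_def by linarith
  also have "\<dots> \<le> C" using L H by (simp add: algebra_simps)
  finally show ?thesis unfolding C_def by simp
qed

subsection \<open>Small \<open>k\<close>\<close>

lemma card_divisors_le_if_many_nondivisors:
  assumes "X \<subseteq> k_sets - divisors" "(n - 1) choose (k - 1) \<le> card X"
  shows "card divisors \<le> (n - 1) choose k"
proof -
  have sub: "divisors \<subseteq> k_sets" by (auto simp: divisors_def)
  have "card X \<le> card (k_sets - divisors)" using assms finite_k_sets by (intro card_mono) auto
  also have "\<dots> = card k_sets - card divisors" using sub finite_divisors by (simp add: card_Diff_subset)
  also have "card k_sets = n choose k" unfolding k_sets_def using fin by (simp add: n_subsets)
  \<comment> \<open>Pascal's rule explains the required number of non-divisors.\<close>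
  also have "\<dots> = ((n - 1) choose (k - 1)) + ((n - 1) choose k)" using k by (intro choose_reduce_nat) auto
  finally have "(n - 1) choose (k - 1) \<le> ((n - 1) choose (k - 1)) + ((n - 1) choose k) - card divisors"
    using assms(2) by linarith
  \<comment> \<open>The subtraction above is truncated; positivity rules out that it has collapsed
    to 0.\<close>
  moreover have "0 < (n - 1) choose (k - 1)" using k by (simp add: zero_less_binomial_iff)
  ultimately show ?thesis by linarith
qed

lemma card_nondivisors_Un:
  assumes N: "N1 \<subseteq> k_sets - divisors" "N2 \<subseteq> k_sets - divisors"
    and "real ((n - 1) choose (k - 1)) \<le> real (card N1) + real (card N2) - real (card (N1 \<inter> N2))"
  shows "card divisors \<le> (n - 1) choose k"
proof (rule card_divisors_le_if_many_nondivisors)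
  have "finite N1" "finite N2" using N finite_k_sets finite_subset by blast+
  from card_Un_Int[OF this] assms(3) show "(n - 1) choose (k - 1) \<le> card (N1 \<union> N2)" by linarith
qed (use N in auto)

section \<open>Heavy elements and close pairs as sources of non-divisors\<close>

lemma card_k_sets_containing:
  "X \<subseteq> A \<Longrightarrow> card X \<le> k \<Longrightarrow> card {B \<in> k_sets. X \<subseteq> B} = (n - card X) choose (k - card X)"
  using card_subsets_containing[OF fin] by (simp add: k_sets_def)

text \<open>Divisors through \<open>b\<close> have weight at least \<open>v\<close>, which leaves at
  most \<open>s / v\<close> values. Removing \<open>b\<close> shifts these values by
  \<open>w b\<close> and leaves \<open>k - 1\<close> elements of \<open>A - {b}\<close> with a
  prescribed weight.\<close>

lemma card_divisors_containing:
  assumes b: "b \<in> A" and v: "0 < v" "v \<le> w b"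
  shows "real (card {B \<in> divisors. b \<in> B}) * (real n - real k + 1)
           \<le> real s / v * real ((n - 1) choose (k - 1))"
proof -
  let ?S = "multiples_of_unit_fracs s \<inter> {v..}"
  let ?V = "(\<lambda>u. u - w b) ` ?S"
  let ?H = "{C. C \<subseteq> A - {b} \<and> card C = k - 1 \<and> sum w C \<in> ?V}"
  have finS: "finite ?S" using v(1) by (rule multiples_of_unit_fracs_above)
  have "inj_on (\<lambda>B. B - {b}) {B \<in> divisors. b \<in> B}"
    by (rule inj_onI) blast
  moreover have "(\<lambda>B. B - {b}) ` {B \<in> divisors. b \<in> B} \<subseteq> ?H"
  proof (intro image_subsetI)
    fix B assume "B \<in> {B \<in> divisors. b \<in> B}"
    hence B: "B \<subseteq> A" "card B = k" "sum w B \<in> multiples_of_unit_fracs s" "b \<in> B"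
      by (auto simp: divisors_def k_sets_def)
    have fB: "finite B" using B(1) by (rule finite_subset_A)
    have "sum w B \<in> ?S" using B(3) v weight_le_sum[OF B(1,4)] by simp
    moreover have "sum w (B - {b}) = sum w B - w b" using fB B(4) by (simp add: sum_diff1)
    ultimately have "sum w (B - {b}) \<in> ?V" by blast
    thus "B - {b} \<in> ?H" using B fB by auto
  qed
  ultimately have "card {B \<in> divisors. b \<in> B} \<le> card ?H"
    using fin by (intro card_inj_on_le) auto
  moreover have "card ?H * (card (A - {b}) + 1 - (k - 1)) \<le> card ?V * (card (A - {b}) choose (k - 1))"
  proof (rule card_subsets_fixed_sums_up)
    show "inj_on w (A - {b})" using inj by (rule inj_on_subset) auto
  qed (use fin finS k in auto)
  ultimately have "card {B \<in> divisors. b \<in> B} * (card (A - {b}) + 1 - (k - 1))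
      \<le> card ?V * (card (A - {b}) choose (k - 1))"
    by (meson le_trans mult_le_mono1)
  also have "\<dots> \<le> card ?S * (card (A - {b}) choose (k - 1))"
    using finS by (intro mult_le_mono1 card_image_le)
  finally have "card {B \<in> divisors. b \<in> B} * (n + 1 - k) \<le> card ?S * ((n - 1) choose (k - 1))"
    using b fin k by simp
  hence "real (card {B \<in> divisors. b \<in> B}) * real (n + 1 - k) \<le> real (card ?S) * real ((n - 1) choose (k - 1))"
    unfolding of_nat_mult[symmetric] by (rule of_nat_mono)
  also have "\<dots> \<le> real s / v * real ((n - 1) choose (k - 1))"
    using v by (intro mult_right_mono multiples_of_unit_fracs_above) auto
  finally show ?thesis using k by (simp add: of_nat_diff algebra_simps)
qed

text \<open>With \<open>C\<close> the number of \<open>k\<close>-sets through one element, at most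
  \<open>C / 6\<close> of these are divisors for each heavy element, and at most
  \<open>C / 2\<close> sets contain both. This suffices since 5/6 + 5/6 - 1/2 exceeds 1.\<close>

lemma card_divisors_le_two_heavy:
  assumes b: "b1 \<in> A" "b2 \<in> A" "b1 \<noteq> b2" and v: "12 * real s / real n \<le> w b1" "12 * real s / real n \<le> w b2"
    and sparse: "16 * k \<le> n"
  shows "card divisors \<le> (n - 1) choose k"
proof -
  define C where "C = real ((n - 1) choose (k - 1))"
  let ?N = "\<lambda>b. {B \<in> k_sets - divisors. b \<in> B}"
  have n: "0 < real n" using k by auto
  have C0: "0 \<le> C" unfolding C_def by simp
  have lower: "5 / 6 * C \<le> real (card (?N b))" if b: "b \<in> A" and v: "12 * real s / real n \<le> w b" for b
  proof -
    let ?D = "{B \<in> divisors. b \<in> B}"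
    have "real (card ?D) * (real n - real k + 1) \<le> real s / (12 * real s / real n) * C"
      unfolding C_def using b v n s by (intro card_divisors_containing) auto
    also have "\<dots> = real n / 12 * C" using s by simp
    finally have "real (card ?D) * (real n - real k + 1) \<le> real n / 12 * C" .
    moreover have "real (card ?D) * (real n / 2) \<le> real (card ?D) * (real n - real k + 1)"
      using sparse by (intro mult_left_mono) auto
    ultimately have "real n * real (card ?D) \<le> real n * (C / 6)" by (simp add: mult.commute)
    hence D: "real (card ?D) \<le> C / 6" using n by (simp only: mult_le_cancel_left_pos)
    have "{B \<in> k_sets. {b} \<subseteq> B} = ?D \<union> ?N b" by (auto simp: divisors_def)
    hence "card {B \<in> k_sets. {b} \<subseteq> B} \<le> card ?D + card (?N b)" 
      using card_Un_le[of ?D "?N b"] by (simp only:)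
    moreover have "real (card {B \<in> k_sets. {b} \<subseteq> B}) = C"
      unfolding C_def using card_k_sets_containing[of "{b}"] b k by simp
    ultimately show ?thesis using D by linarith
  qed
  have "card (?N b1 \<inter> ?N b2) \<le> card {B \<in> k_sets. {b1, b2} \<subseteq> B}"
    using finite_k_sets by (intro card_mono) auto
  also have "\<dots> = (n - 2) choose (k - 2)"
    using card_k_sets_containing[of "{b1, b2}"] b k by (simp add: numeral_2_eq_2)
  finally have I: "real (card (?N b1 \<inter> ?N b2)) \<le> real ((n - 2) choose (k - 2))" by simp
  have "(k - 1) * ((n - 1) choose (k - 1)) = (n - 1) * ((n - 2) choose (k - 2))"
    using binomial_absorption[of "k - 2" "n - 1"] k by (simp add: numeral_2_eq_2 Suc_diff_Suc)
  hence "real (k - 1) * C = real (n - 1) * real ((n - 2) choose (k - 2))"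
    unfolding C_def of_nat_mult[symmetric] by (rule arg_cong)
  moreover have "real (k - 1) * C \<le> real (n - 1) * (C / 2)"
  proof -
    have "real (k - 1) * C \<le> (real (n - 1) / 2) * C" using sparse k C0 by (intro mult_right_mono) auto
    thus ?thesis by simp
  qed
  ultimately have "real (n - 1) * real ((n - 2) choose (k - 2)) \<le> real (n - 1) * (C / 2)" by linarith
  moreover have "0 < real (n - 1)" using k by simp
  ultimately have "real ((n - 2) choose (k - 2)) \<le> C / 2" by (simp only: mult_le_cancel_left_pos)
  hence "C \<le> real (card (?N b1)) + real (card (?N b2)) - real (card (?N b1 \<inter> ?N b2))"
    using lower[OF b(1) v(1)] lower[OF b(2) v(2)] I C0 by linarith
  thus ?thesis unfolding C_def by (intro card_nondivisors_Un[of "?N b1" "?N b2"]) auto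
qed

text \<open>If \<open>u + a = s / m'\<close> and \<open>u + b = s / m\<close>, then
  \<open>m' - m\<close> is a strictly decreasing function of \<open>u\<close>, so it determines
  \<open>u\<close>. It is largest at \<open>u = 0\<close>, where the hypothesis bounds it by
  \<open>K\<close>.\<close>

lemma common_completion_weights:
  fixes K :: nat and a b :: real
  defines "U \<equiv> {u. 0 \<le> u \<and> u + a \<in> multiples_of_unit_fracs s \<and> u + b \<in> multiples_of_unit_fracs s}"
  assumes ab: "0 < a" "a < b" and K: "real s * (b - a) \<le> real K * (a * b)"
  shows "finite U" and "card U \<le> K"
proof -
  \<comment> \<open>On \<open>U\<close>, \<open>e\<close> is the difference of the two denominators, an integer between \<open>1\<close> and \<open>K\<close>.\<close>
  define e where "e u = real s / (u + a) - real s / (u + b)" for u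
  have e: "e u = real s * (b - a) / ((u + a) * (u + b))" if "0 \<le> u" for u
    using that ab unfolding e_def by (simp add: field_simps)
  have decreasing: "e u' < e u" if "0 \<le> u" "u < u'" for u u'
  proof -
    have "(u + a) * (u + b) < (u' + a) * (u' + b)" using that ab by (intro mult_strict_mono) auto
    moreover have "0 < (u + a) * (u + b)" using that ab by simp
    moreover have "0 < real s * (b - a)" using ab s by simp
    ultimately show ?thesis using that e[of u] e[of u'] by (simp add: divide_strict_left_mono)
  qed
  have inj_e: "inj_on e U"
  proof (rule inj_onI)
    fix u u' assume "u \<in> U" "u' \<in> U" "e u = e u'"
    thus "u = u'" using decreasing[of u u'] decreasing[of u' u] unfolding U_def
      by (cases u u' rule: linorder_cases) auto
  qed
  have sub: "e ` U \<subseteq> real ` {1..K}"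
  proof (intro image_subsetI)
    fix u assume u: "u \<in> U"
    then obtain m m' where m: "0 < m" "u + b = real s / real m" "0 < m'" "u + a = real s / real m'"
      by (auto simp: U_def multiples_of_unit_fracs_def)
    have eu: "e u = real m' - real m" unfolding e_def m using m s by simp
    have u0: "0 \<le> u" using u by (simp add: U_def)
    have "0 < e u" using u0 ab s e[OF u0] by simp
    moreover have "e u \<le> real K"
    proof -
      have "real K * (a * b) \<le> real K * ((u + a) * (u + b))"
        using u0 ab by (intro mult_left_mono mult_mono) auto
      hence "real s * (b - a) \<le> real K * ((u + a) * (u + b))" using K by linarith
      thus ?thesis unfolding e[OF u0] using u0 ab by (subst pos_divide_le_eq) auto
    qed
    ultimately have "e u = real (m' - m)" "m' - m \<in> {1..K}" unfolding eu by auto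
    thus "e u \<in> real ` {1..K}" by blast
  qed
  show "finite U" using sub inj_e finite_imageD finite_subset by (metis finite_atLeastAtMost finite_imageI)
  have "card U \<le> card (real ` {1..K})" using inj_e sub by (intro card_inj_on_le) auto
  also have "\<dots> \<le> K" using card_image_le[of "{1..K}" real] by simp
  finally show "card U \<le> K" .
qed

text \<open>The weight of a common completion is one of at most \<open>K\<close> values, so
  prescribing it costs a factor of order \<open>K / (n - k)\<close> among the (\<open>k\<close> -
  1)-subsets of \<open>A - {x, y}\<close>.\<close>

lemma card_common_completions:
  assumes xy: "x \<in> A" "y \<in> A" "w x < w y" and K: "real s * (w y - w x) \<le> real K * (w x * w y)"
  shows "card {C. C \<subseteq> A - {x, y} \<and> card C = k - 1 \<and> insert x C \<in> divisors \<and> insert y C \<in> divisors} * (n - k)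
           \<le> K * ((n - 2) choose (k - 1))"
proof -
  let ?B = "{C. C \<subseteq> A - {x, y} \<and> card C = k - 1 \<and> insert x C \<in> divisors \<and> insert y C \<in> divisors}"
  let ?U = "{u. 0 \<le> u \<and> u + w x \<in> multiples_of_unit_fracs s \<and> u + w y \<in> multiples_of_unit_fracs s}"
  let ?H = "{C. C \<subseteq> A - {x, y} \<and> card C = k - 1 \<and> sum w C \<in> ?U}"
  have U: "finite ?U" "card ?U \<le> K"
    using common_completion_weights[OF pos[OF xy(1)] xy(3) K] by auto
  have "x \<noteq> y" using xy(3) by auto
  have cA: "card (A - {x, y}) = n - 2" using xy(1,2) \<open>x \<noteq> y\<close> fin by (simp add: card_Diff_subset numeral_2_eq_2)
  have "?B \<subseteq> ?H"
  proof clarify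
    fix C assume C: "C \<subseteq> A - {x, y}" "insert x C \<in> divisors" "insert y C \<in> divisors"
    have "finite C" using C(1) by (intro finite_subset_A) auto
    moreover have "x \<notin> C" "y \<notin> C" using C(1) by auto
    ultimately have "sum w C + w x = sum w (insert x C)" "sum w C + w y = sum w (insert y C)" by simp_all
    moreover have "0 \<le> sum w C" using C(1) pos by (intro sum_nonneg) (auto intro: less_imp_le)
    ultimately show "0 \<le> sum w C \<and> sum w C + w x \<in> multiples_of_unit_fracs s
        \<and> sum w C + w y \<in> multiples_of_unit_fracs s"
      using C(2,3) by (simp add: divisors_def)
  qed
  hence "card ?B \<le> card ?H" using fin by (intro card_mono) auto
  hence "card ?B * (card (A - {x, y}) + 1 - (k - 1)) \<le> card ?H * (card (A - {x, y}) + 1 - (k - 1))"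
    by (rule mult_le_mono1)
  also have "\<dots> \<le> card ?U * (card (A - {x, y}) choose (k - 1))"
  proof (rule card_subsets_fixed_sums_up)
    show "inj_on w (A - {x, y})" using inj by (rule inj_on_subset) auto
  qed (use fin U k in auto)
  also have "\<dots> \<le> K * (card (A - {x, y}) choose (k - 1))" using U(2) by (rule mult_le_mono1)
  finally have "card ?B * (n - 2 + 1 - (k - 1)) \<le> K * ((n - 2) choose (k - 1))" unfolding cA .
  moreover have "n - 2 + 1 - (k - 1) = n - k" using k by linarith
  ultimately show ?thesis by (simp only:)
qed

text \<open>Unless both extensions of \<open>C\<close> are divisors, \<open>f\<close> picks one that
  is not. Deleting \<open>x\<close> and \<open>y\<close> from the result gives back
  \<open>C\<close>, so no non-divisor is picked twice.\<close>

lemma card_nondivisors_separating: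
  assumes xy: "x \<in> A" "y \<in> A" "x \<noteq> y"
  shows "(n - 2) choose (k - 1)
    \<le> card {B \<in> k_sets - divisors. (x \<in> B) \<noteq> (y \<in> B)}
      + card {C. C \<subseteq> A - {x, y} \<and> card C = k - 1 \<and> insert x C \<in> divisors \<and> insert y C \<in> divisors}"
    (is "_ \<le> card ?N + card ?B")
proof -
  let ?C = "{C. C \<subseteq> A - {x, y} \<and> card C = k - 1}"
  define f where "f C = (if insert x C \<in> divisors then insert y C else insert x C)" for C
  have f: "f C - {x, y} = C" if "C \<in> ?C" for C
    using that unfolding f_def by auto
  have "inj_on f (?C - ?B)"
  proof (rule inj_onI)
    fix C C' assume C: "C \<in> ?C - ?B" "C' \<in> ?C - ?B" and eq: "f C = f C'"
    have "C = f C - {x, y}" using f[OF DiffD1[OF C(1)]] by (rule sym)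
    also have "\<dots> = C'" unfolding eq using C(2) by (intro f) (rule DiffD1)
    finally show "C = C'" .
  qed
  moreover have "f ` (?C - ?B) \<subseteq> ?N"
  proof (intro image_subsetI)
    fix C assume C: "C \<in> ?C - ?B"
    hence C': "x \<notin> C" "y \<notin> C" "C \<subseteq> A" "card C = k - 1" by blast+
    have "finite C" using C'(3) by (rule finite_subset_A)
    hence "insert x C \<in> k_sets" "insert y C \<in> k_sets"
      using C' xy k by (simp_all add: k_sets_def)
    moreover have "insert x C \<notin> divisors \<or> insert y C \<notin> divisors" using C by blast
    ultimately show "f C \<in> ?N" using C' xy(3) by (simp add: f_def)
  qed
  ultimately have "card (?C - ?B) \<le> card ?N" using finite_k_sets by (intro card_inj_on_le) auto
  moreover have "card ?C = (n - 2) choose (k - 1)"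
    using xy fin by (simp add: n_subsets card_Diff_subset numeral_2_eq_2)
  moreover have "card ?C \<le> card (?C - ?B) + card ?B"
  proof -
    have "card ?C \<le> card ((?C - ?B) \<union> ?B)" using fin by (intro card_mono) auto
    thus ?thesis using card_Un_le le_trans by blast
  qed
  ultimately show ?thesis by linarith
qed

text \<open>Each pair is separated by at least \<open>15 / 16 * C\<close> non-divisors, and at most
  \<open>4 / 15 * C\<close> sets separate both pairs. The remaining 193/120 of \<open>C\<close>
  exceeds the required \<open>C1\<close>, which is at most \<open>16 / 15 * C\<close>.\<close>

lemma card_divisors_le_two_close_pairs:
  assumes A: "{x, y, x', y'} \<subseteq> A" and dist: "distinct [x, y, x', y']"
    and close: "real s * \<bar>w x - w y\<bar> \<le> real K * (w x * w y)"
      "real s * \<bar>w x' - w y'\<bar> \<le> real K * (w x' * w y')"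
    and sparse: "16 * k \<le> n" and K: "32 * K \<le> n"
  shows "card divisors \<le> (n - 1) choose k"
proof -
  define C where "C = real ((n - 2) choose (k - 1))"
  define C1 where "C1 = real ((n - 1) choose (k - 1))"
  define D where "D = real ((n - 2) choose (k - 2))"
  let ?N = "\<lambda>x y. {B \<in> k_sets - divisors. (x \<in> B) \<noteq> (y \<in> B)}"
  have C0: "0 \<le> C" "0 \<le> C1" unfolding C_def C1_def by simp_all
  have nk: "0 < real (n - k)" "16 * real K \<le> real (n - k)" "15 * real (k - 1) \<le> real (n - k)"
    "15 / 16 * real (n - 1) \<le> real (n - k)"
    using sparse K k by linarith+
  have lower: "15 / 16 * C \<le> real (card (?N a b))"
    if ab: "a \<in> A" "b \<in> A" "w a < w b" "real s * (w b - w a) \<le> real K * (w a * w b)" for a b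
  proof -
    let ?B = "{C. C \<subseteq> A - {a, b} \<and> card C = k - 1 \<and> insert a C \<in> divisors \<and> insert b C \<in> divisors}"
    have "card ?B * (n - k) \<le> K * ((n - 2) choose (k - 1))"
      using ab by (rule card_common_completions)
    hence "real (card ?B) * real (n - k) \<le> real K * C"
      unfolding C_def of_nat_mult[symmetric] by (rule of_nat_mono)
    also have "\<dots> \<le> (C / 16) * real (n - k)"
      using mult_right_mono[OF nk(2) C0(1)] by (simp add: algebra_simps)
    finally have "real (card ?B) \<le> C / 16" using nk(1) by (simp only: mult_le_cancel_right_pos)
    moreover have "(n - 2) choose (k - 1) \<le> card (?N a b) + card ?B"
      using ab by (intro card_nondivisors_separating) auto
    hence "C \<le> real (card (?N a b)) + real (card ?B)"
      unfolding C_def of_nat_add[symmetric] by (rule of_nat_mono)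
    ultimately show ?thesis by linarith
  qed
  have lower_abs: "15 / 16 * C \<le> real (card (?N a b))"
    if ab: "a \<in> A" "b \<in> A" "a \<noteq> b" "real s * \<bar>w a - w b\<bar> \<le> real K * (w a * w b)" for a b
  proof (cases "w a < w b")
    case True
    with ab show ?thesis by (intro lower) auto
  next
    case False
    moreover have "w a \<noteq> w b" using ab inj by (auto dest: inj_onD)
    ultimately have "15 / 16 * C \<le> real (card (?N b a))"
      using ab by (intro lower) (auto simp: mult.commute)
    moreover have "?N b a = ?N a b" by blast
    ultimately show ?thesis by simp
  qed
  let ?P = "\<lambda>p q. {B \<in> k_sets. {p, q} \<subseteq> B}"
  have P: "card (?P p q) = (n - 2) choose (k - 2)" if "p \<in> A" "q \<in> A" "p \<noteq> q" for p q
    using card_k_sets_containing[of "{p, q}"] that k by (simp add: numeral_2_eq_2)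
  \<comment> \<open>A set separating both pairs contains one element from each, which leaves four
    choices of two fixed elements.\<close>
  have "card (?N x y \<inter> ?N x' y') \<le> card ((?P x x' \<union> ?P x y') \<union> (?P y x' \<union> ?P y y'))"
    using finite_k_sets by (intro card_mono) auto
  also have "\<dots> \<le> (card (?P x x') + card (?P x y')) + (card (?P y x') + card (?P y y'))"
    by (intro order_trans[OF card_Un_le] add_mono card_Un_le)
  also have "\<dots> = 4 * ((n - 2) choose (k - 2))"
    using A dist P[of x x'] P[of x y'] P[of y x'] P[of y y'] by simp
  finally have I: "real (card (?N x y \<inter> ?N x' y')) \<le> 4 * D" unfolding D_def by linarith
  have "Suc (k - 2) = k - 1" "n - 2 - (k - 2) = n - k" using k by linarith+
  hence "(k - 1) * ((n - 2) choose (k - 1)) = (n - k) * ((n - 2) choose (k - 2))"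
    using binomial_Suc_mult[of "k - 2" "n - 2"] by simp
  hence "real (k - 1) * C = real (n - k) * D"
    unfolding C_def D_def of_nat_mult[symmetric] by (rule arg_cong)
  moreover have "15 * real (k - 1) * C \<le> real (n - k) * C" using nk(3) C0(1) by (rule mult_right_mono)
  ultimately have "real (n - k) * (15 * D) \<le> real (n - k) * C" by (simp add: mult.left_commute)
  hence D: "15 * D \<le> C" using nk(1) by (simp only: mult_le_cancel_left_pos)
  have "(n - k) * ((n - 1) choose (k - 1)) = (n - 1) * ((n - 2) choose (k - 1))"
    using binomial_absorb_comp[of "n - 1" "k - 1"] k by (simp add: numeral_2_eq_2)
  hence "real (n - k) * C1 = real (n - 1) * C"
    unfolding C_def C1_def of_nat_mult[symmetric] by (rule arg_cong)
  moreover have "15 / 16 * real (n - 1) * C1 \<le> real (n - k) * C1" using nk(4) C0(2) by (rule mult_right_mono)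
  ultimately have "real (n - 1) * (15 / 16 * C1) \<le> real (n - 1) * C" by (simp add: mult.left_commute)
  moreover have "0 < real (n - 1)" using k by simp
  ultimately have C: "15 / 16 * C1 \<le> C" by (simp only: mult_le_cancel_left_pos)
  have "15 / 16 * C \<le> real (card (?N x y))" "15 / 16 * C \<le> real (card (?N x' y'))"
    using A dist close by (intro lower_abs; simp)+
  hence "C1 \<le> real (card (?N x y)) + real (card (?N x' y')) - real (card (?N x y \<inter> ?N x' y'))"
    using I D C C0 by linarith
  thus ?thesis unfolding C1_def by (intro card_nondivisors_Un[of "?N x y" "?N x' y'"]) auto
qed

lemma card_divisors_le_sparse:
  assumes light: "\<And>x. x \<in> A \<Longrightarrow> w x \<le> real s / real (s + 1)"
    and sparse: "16 * k \<le> n" and n: "73728 * (s + 1) ^ 6 \<le> n"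
  shows "card divisors \<le> (n - 1) choose k"
proof (cases "\<exists>b1\<in>A. \<exists>b2\<in>A. b1 \<noteq> b2 \<and> 12 * real s / real n \<le> w b1 \<and> 12 * real s / real n \<le> w b2")
  case True
  thus ?thesis using sparse card_divisors_le_two_heavy by blast
next
  case False
  define r where "r = real (s + 1)"
  define N where "N = real n"
  \<comment> \<open>Elements lighter than \<open>c / N\<close> weigh at most \<open>c\<close>
    together, half of the \<open>1 / r\<close> left beside one element of weight
    \<open>s / r\<close>; \<open>V / N\<close> is the heaviness bound of the case
    distinction.\<close>
  define c V where "c = 1 / (2 * r)" and "V = 12 * real s"
  define D where "D = 24 * (r * real s)"
  define G where "G = 2 * D * V"
  \<comment> \<open>This solves \<open>s * G = K * c\<^sup>2\<close>, turning the spacing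
    \<open>G / N\<^sup>2\<close> into closeness with constant \<open>K\<close>. The threshold 73728
    is 32 * 2304.\<close>
  define K where "K = 2304 * (s ^ 3 * (s + 1) ^ 3)"
  define X where "X = {x \<in> A. V / N \<le> w x}"
  define M where "M = {x \<in> A. c / N \<le> w x \<and> w x < V / N}"
  have r: "1 \<le> r" "1 \<le> real s" "real s \<le> r" using s unfolding r_def by simp_all
  have N: "0 < N" unfolding N_def using k by auto
  have pos': "0 < c" "0 < V" "0 < D" "0 < G" using r by (simp_all add: c_def V_def D_def G_def)
  have finM: "finite M" using fin by (simp add: M_def)
  \<comment> \<open>\<open>X\<close> has at most one element because two heavy elements are
    excluded.\<close>
  have X: "sum w X \<le> real s / r"
  proof (cases "X = {}")
    case False
    then obtain x where "x \<in> X" by blast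
    hence "X = {x}" using \<open>\<not> (\<exists>b1\<in>A. _ b1)\<close> unfolding X_def V_def N_def by blast
    thus ?thesis using light[of x] unfolding X_def r_def by auto
  qed (use r in simp)
  have "sum w (A - X) \<le> (\<Sum>x\<in>A - X. c / N + (if x \<in> M then V / N else 0))"
    using divide_pos_pos[OF pos'(1) N] by (intro sum_mono) (auto simp: X_def M_def)
  also have "\<dots> \<le> (\<Sum>x\<in>A. c / N + (if x \<in> M then V / N else 0))"
    using fin pos' N by (intro sum_mono2) auto
  also have "\<dots> = c + real (card M) * (V / N)"
  proof -
    have "A \<inter> M = M" unfolding M_def by blast
    thus ?thesis using fin N k by (auto simp: sum.distrib sum.If_cases N_def)
  qed
  finally have "1 \<le> real s / r + c + real (card M) * (V / N)"
    using X total fin sum_diff[OF fin, of X w] unfolding X_def by auto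
  moreover have "1 - real s / r - c = c"
    using r unfolding c_def r_def by (simp add: field_simps)
  ultimately have "c \<le> real (card M) * (V / N)" by linarith
  hence "N * c \<le> real (card M) * V" using N by (simp add: field_simps)
  hence "N / D \<le> real (card M)" using r unfolding c_def V_def D_def by (simp add: field_simps)
  \<comment> \<open>This makes half of \<open>N / D\<close> exceed 3, room for the extra cell at 0
    and the two spare elements needed for a second collision.\<close>
  moreover have "6 * D < N"
  proof -
    have "(s + 1) * s \<le> (s + 1) ^ 6"
    proof -
      have "(s + 1) * s \<le> (s + 1) ^ 2" by (simp add: power2_eq_square)
      also have "\<dots> \<le> (s + 1) ^ 6" by (rule power_increasing) auto
      finally show ?thesis .
    qed
    moreover have "1 \<le> (s + 1) ^ 6" by simp
    ultimately have "144 * ((s + 1) * s) < n" using n by linarith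
    hence "real (144 * ((s + 1) * s)) < real n" by (rule of_nat_less_iff[THEN iffD2])
    thus ?thesis unfolding D_def r_def N_def by (simp add: algebra_simps)
  qed
  hence "6 < N / D" using pos' by (simp add: field_simps)
  ultimately have cardM: "N / (2 * D) + 3 < real (card M)" by simp
  \<comment> \<open>Cells of length \<open>G / N\<^sup>2\<close>; with \<open>G = 2 * D * V\<close>
    about \<open>N / (2 * D)\<close> of them cover all weights below \<open>V / N\<close>, half the
    guaranteed size of \<open>M\<close>.\<close>
  define f where "f x = nat \<lfloor>w x * (N * N / G)\<rfloor>" for x
  define T where "T = {..nat \<lfloor>N / (2 * D)\<rfloor>}"
  have "real (card T) \<le> N / (2 * D) + 1" unfolding T_def using N pos' by simp
  hence cT: "card T + 2 < card M" using cardM by linarith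
  have fT: "f ` M \<subseteq> T"
  proof (intro image_subsetI)
    fix x assume x: "x \<in> M"
    have "w x * (N * N / G) \<le> V / N * (N * N / G)"
      using x N pos' unfolding M_def by (intro mult_right_mono) auto
    also have "\<dots> = N / (2 * D)" using N pos' unfolding G_def by (simp add: field_simps)
    finally show "f x \<in> T" unfolding f_def T_def by (simp add: nat_mono floor_mono)
  qed
  obtain x y x' y' where xy: "{x, y, x', y'} \<subseteq> M" "distinct [x, y, x', y']" "f x = f y" "f x' = f y'"
    by (rule two_disjoint_collisions[OF finM _ fT cT]) (simp add: T_def)
  have close: "real s * \<bar>w a - w b\<bar> \<le> real K * (w a * w b)" if ab: "a \<in> M" "b \<in> M" "f a = f b" for a b
  proof -
    have wab: "0 < w a" "0 < w b" "c / N \<le> w a" "c / N \<le> w b" using ab pos by (auto simp: M_def)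
    \<comment> \<open>Nonnegativity ensures that \<open>nat\<close> loses nothing, so equal cells
      mean equal floors.\<close>
    have "0 \<le> w a * (N * N / G)" "0 \<le> w b * (N * N / G)" using wab N pos' by simp_all
    hence "\<bar>w a * (N * N / G) - w b * (N * N / G)\<bar> \<le> 1"
      using ab(3) unfolding f_def by linarith
    moreover have "w a * (N * N / G) - w b * (N * N / G) = (w a - w b) * (N * N / G)"
      by (simp only: left_diff_distrib)
    ultimately have "\<bar>w a - w b\<bar> * (N * N / G) \<le> 1" using N pos' by (simp add: abs_mult)
    hence "\<bar>w a - w b\<bar> \<le> G / (N * N)" using N pos' by (simp add: field_simps)
    hence "real s * \<bar>w a - w b\<bar> \<le> real s * (G / (N * N))" by (intro mult_left_mono) auto
    also have "\<dots> = real K * (c / N * (c / N))"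
    proof -
      have "real s * G = real K * (c * c)"
        using r unfolding G_def D_def V_def c_def K_def r_def[symmetric] of_nat_mult of_nat_power
        by (simp add: field_simps power3_eq_cube)
      thus ?thesis by (simp add: field_simps)
    qed
    also have "\<dots> \<le> real K * (w a * w b)"
      using wab N pos' by (intro mult_left_mono mult_mono) auto
    finally show ?thesis .
  qed
  have "s ^ 3 * (s + 1) ^ 3 \<le> (s + 1) ^ 3 * (s + 1) ^ 3" by (intro mult_le_mono1 power_mono) auto
  also have "\<dots> = (s + 1) ^ 6" by (simp only: power_add[symmetric]) simp
  finally have K: "32 * K \<le> n" using n unfolding K_def by linarith
  have "{x, y, x', y'} \<subseteq> A" using xy(1) unfolding M_def by blast
  thus ?thesis
    using xy sparse K by (intro card_divisors_le_two_close_pairs[of x y x' y' K] close) auto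
qed

section \<open>The upper bound for all k\<close>

lemma card_divisors_le:
  assumes n: "73728 * (s + 1) ^ 6 \<le> n"
  shows "card divisors \<le> (n - 1) choose k"
proof (cases "\<exists>x\<in>A. real s / real (s + 1) < w x")
  case True
  thus ?thesis using card_divisors_le_if_dominant by blast
next
  case False
  hence light: "w x \<le> real s / real (s + 1)" if "x \<in> A" for x using that by force
  show ?thesis
  proof (cases "16 * k \<le> n")
    case True
    thus ?thesis using light n by (intro card_divisors_le_sparse)
  next
    case False
    have "32768 * (s + 1) ^ 4 \<le> 73728 * (s + 1) ^ 6"
      by (intro mult_le_mono power_increasing) auto
    thus ?thesis using False light n by (intro card_divisors_le_dense) auto
  qed
qed

end

subsection \<open>The maximum number of divisors\<close>

lemma num_s_divisors_le_binomial:
  assumes A: "A \<in> pos_sets n" and s: "1 \<le> s" and k: "1 < k" "k < n - 1"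
    and n: "73728 * (s + 1) ^ 6 \<le> n"
  shows "num_s_divisors s k A \<le> (n - 1) choose k"
proof -
  have fin: "finite A" and cA: "card A = n" and pos: "\<And>a. a \<in> A \<Longrightarrow> 0 < a"
    using A by (auto simp: pos_sets_def)
  define W where "W = real (\<Sum>A)"
  define w where "w a = real a / W" for a
  have "A \<noteq> {}" using cA k by auto
  hence "0 < \<Sum>A" using fin pos by (intro sum_pos) auto
  hence W: "0 < W" unfolding W_def by (simp only: of_nat_0_less_iff)
  have sum_w: "sum w B = real (\<Sum>B) / W" for B
    unfolding w_def by (simp add: sum_divide_distrib)
  interpret unit_weights A w s k
  proof
    show "inj_on w A" using W by (auto simp: w_def inj_on_def)
    show "sum w A = 1" using W by (simp only: sum_w) (simp add: W_def)
  qed (use fin cA pos s k W in \<open>auto simp: w_def\<close>)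
  have "{B. card B = k \<and> s_divisor s A B} \<subseteq> divisors"
  proof
    fix B assume "B \<in> {B. card B = k \<and> s_divisor s A B}"
    hence BA: "B \<subseteq> A" "card B = k" and "\<Sum>B dvd s * \<Sum>A" by (auto simp: s_divisor_def)
    then obtain m where m: "s * \<Sum>A = \<Sum>B * m" by (auto elim: dvdE)
    \<comment> \<open>This excludes \<open>m = 0\<close>, so \<open>s / m\<close> is a genuine
      quotient.\<close>
    have "0 < s * \<Sum>A" using s \<open>0 < \<Sum>A\<close> by simp
    hence "0 < m" "0 < \<Sum>B" unfolding m by (auto simp: zero_less_mult_iff)
    have "real s * W = real (\<Sum>B) * real m" unfolding W_def of_nat_mult[symmetric] m ..
    hence "sum w B = real s / real m" using W \<open>0 < m\<close> unfolding sum_w by (simp add: field_simps)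
    thus "B \<in> divisors"
      using BA \<open>0 < m\<close> by (auto simp: divisors_def k_sets_def multiples_of_unit_fracs_def)
  qed
  hence "num_s_divisors s k A \<le> card divisors"
    unfolding num_s_divisors_def using finite_divisors by (rule card_mono[rotated])
  also have "\<dots> \<le> (n - 1) choose k" using card_divisors_le n unfolding cA by simp
  finally show ?thesis .
qed

text \<open>Adjoin to \<open>{1..n - 1}\<close> one huge element that makes the total divisible by
  every sum of a nonempty subset of the small ones; their \<open>k\<close>-subsets are then all
  divisors.\<close>

lemma ex_num_s_divisors_ge_binomial:
  assumes k: "0 < k" and n: "0 < n"
  obtains A where "A \<in> pos_sets n" "(n - 1) choose k \<le> num_s_divisors s k A"
proof -
  define A0 where "A0 = {1..n - 1}"
  define t where "t = \<Sum>A0"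
  \<comment> \<open>The total becomes \<open>fact t * (t + n)\<close>. Subset sums of
    \<open>A0\<close> are at most \<open>t\<close>, hence divide \<open>fact t\<close>, and the
    factor \<open>t + n\<close> pushes \<open>z\<close> to at least \<open>n\<close>, outside
    \<open>A0\<close>.\<close>
  define z where "z = fact t * (t + n) - t"
  have "t + n \<le> fact t * (t + n)" by simp
  hence z: "z + t = fact t * (t + n)" "n \<le> z" unfolding z_def by linarith+
  have zA: "z \<notin> A0" using z(2) n unfolding A0_def by auto
  have fin: "finite A0" "card A0 = n - 1" by (simp_all add: A0_def)
  have "insert z A0 \<in> pos_sets n"
    using fin zA z(2) n by (auto simp: pos_sets_def A0_def)
  moreover have "(n - 1) choose k \<le> num_s_divisors s k (insert z A0)"
  proof -
    have "{B. B \<subseteq> A0 \<and> card B = k} \<subseteq> {B. card B = k \<and> s_divisor s (insert z A0) B}"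
    proof
      fix B assume "B \<in> {B. B \<subseteq> A0 \<and> card B = k}"
      hence B: "B \<subseteq> A0" "card B = k" by auto
      hence fB: "finite B" "B \<noteq> {}" using fin k finite_subset by auto
      have "0 < \<Sum>B" using fB B by (intro sum_pos) (auto simp: A0_def)
      moreover have "\<Sum>B \<le> t" unfolding t_def using B fin by (intro sum_mono2) auto
      ultimately have "\<Sum>B dvd fact t" by (intro dvd_fact) auto
      moreover have "\<Sum>(insert z A0) = fact t * (t + n)"
        using zA fin z(1) by (simp add: t_def)
      ultimately have "\<Sum>B dvd s * \<Sum>(insert z A0)" by simp
      thus "B \<in> {B. card B = k \<and> s_divisor s (insert z A0) B}"
        using B by (auto simp: s_divisor_def)
    qed
    moreover have "finite {B. card B = k \<and> s_divisor s (insert z A0) B}"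
      by (rule finite_subset[of _ "Pow (insert z A0)"]) (use fin in \<open>auto simp: s_divisor_def\<close>)
    ultimately have "card {B. B \<subseteq> A0 \<and> card B = k} \<le> num_s_divisors s k (insert z A0)"
      unfolding num_s_divisors_def by (intro card_mono)
    thus ?thesis using fin by (simp add: n_subsets)
  qed
  ultimately show ?thesis using that by blast
qed

theorem corollary5:
  fixes s :: nat
  assumes "s \<ge> 1"
  shows "finite {(k, n). 1 < k \<and> k < n - 1 \<and> max_s_divisors s k n \<noteq> (n - 1) choose k}"
proof (rule finite_subset)
  let ?N = "73728 * (s + 1) ^ 6"
  show "{(k, n). 1 < k \<and> k < n - 1 \<and> max_s_divisors s k n \<noteq> (n - 1) choose k} \<subseteq> {..<?N} \<times> {..<?N}"
  proof clarify
    fix k n :: nat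
    assume k: "1 < k" "k < n - 1" and neq: "max_s_divisors s k n \<noteq> (n - 1) choose k"
    \<comment> \<open>Bounding \<open>n\<close> is enough, since \<open>k < n - 1\<close> bounds
      \<open>k\<close> as well.\<close>
    have "n < ?N"
    proof (rule ccontr)
      assume "\<not> n < ?N"
      hence le: "num_s_divisors s k A \<le> (n - 1) choose k" if "A \<in> pos_sets n" for A
        using that k assms by (intro num_s_divisors_le_binomial) auto
      obtain A where A: "A \<in> pos_sets n" "(n - 1) choose k \<le> num_s_divisors s k A"
        by (rule ex_num_s_divisors_ge_binomial[of k n s]) (use k in auto)
      have "max_s_divisors s k n = (n - 1) choose k"
        unfolding max_s_divisors_def
      proof (rule Max_eqI)
        show "(n - 1) choose k \<in> num_s_divisors s k ` pos_sets n"
          using A le[OF A(1)] by (intro image_eqI[of _ _ A]) auto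
      qed (use le finite_num_s_divisors_image in auto)
      with neq show False by simp
    qed
    thus "k \<in> {..<?N} \<and> n \<in> {..<?N}" using k by simp
  qed
qed simp

end
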